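(* Let $\Gamma:\mathbb{R}^n\to\mathbb{R}^N$ be linear, let $(e_1,\dots,e_n)$ be the canonical basis of $\mathbb{R}^n$, let $s$ be a positive integer and let $c_0,c_1>0$. Assume that: a) for every $x\in\Sigma_s$, $\|\Gamma x\|_2\ge c_0\|x\|_2$; and b) for every $j\in\{1,\dots,n\}$, $\|\Gamma e_j\|_2\le c_1$. Setting $s_1=\left\lfloor\frac{c_0^2(s-1)}{4c_1^2}\right\rfloor-1$, $\Gamma$ satisfies the exact reconstruction property in $\Sigma_{s_1}$.
   Context: For an integer $k$, $\Sigma_k$ is the set of vectors in $\mathbb{R}^n$ with at most $k$ nonzero coordinates (empty if $k<0$). $\Gamma$ satisfies the exact reconstruction property in $\Sigma_k$ if for every $x_0\in\Sigma_k$, $\operatorname{argmin}\{\|t\|_1:t\in\mathbb{R}^n,\ \Gamma t=\Gamma x_0\}=\{x_0\}$. *)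

theory Defs
  imports "HOL-Analysis.Analysis"
begin

definition l1_norm :: "real ^ 'n \<Rightarrow> real"
  where "l1_norm x = (\<Sum>i\<in>UNIV. \<bar>x $ i\<bar>)"

(* The sparsity level is an integer, so that the set is empty for k < 0. *)
definition sparse_vectors :: "int \<Rightarrow> (real ^ 'n) set"
  where "sparse_vectors k = {x. int (card {i. x $ i \<noteq> 0}) \<le> k}"

(* The argmin is the set of all minimisers: the equality with {x0} states both
   that x0 is a minimiser and that there is no other. *)
definition exact_reconstruction :: "(real ^ 'n \<Rightarrow> real ^ 'm) \<Rightarrow> (real ^ 'n) set \<Rightarrow> bool"
  where "exact_reconstruction \<Gamma> S \<longleftrightarrow>
    (\<forall>x0\<in>S. {t. is_arg_min l1_norm (\<lambda>t. \<Gamma> t = \<Gamma> x0) t} = {x0})"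

end

theory Submission
  imports Defs
begin

text \<open>
  Exact reconstruction holds as soon as every kernel vector \<open>h \<noteq> 0\<close> has less than half of its
  \<open>\<ell>\<^sub>1\<close> mass on any \<open>s1\<close> coordinates (\<open>exact_reconstructionI\<close>): moving from \<open>x0\<close> to \<open>x0 + h\<close>
  lowers the norm by at most the mass of \<open>h\<close> on the support of \<open>x0\<close>, and raises it by all the
  mass off that support.
  By Cauchy-Schwarz, it suffices to bound \<open>\<parallel>h\<parallel>\<^sub>2\<close> by a small multiple of \<open>\<parallel>h\<parallel>\<^sub>1\<close> on the kernel.

  Hypothesis a) only concerns sparse vectors, whereas \<open>h\<close> may have full support. The bridge is
  Maurey's empirical method. Write \<open>h\<close> as a convex combination of the vectors
  \<open>\<plusminus> \<parallel>h\<parallel>\<^sub>1 e\<^sub>j\<close>, and let \<open>V\<close> be the sum of \<open>s\<close> independent copies of the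
  corresponding random vector \<open>Z\<close>. Then \<open>V\<close> is always \<open>s\<close>-sparse, so that the quadratic form
  \<open>Q v = \<parallel>\<Gamma> v\<parallel>\<^sup>2 - c0\<^sup>2 \<parallel>v\<parallel>\<^sup>2\<close> is nonnegative at \<open>V\<close>. On the other hand
  \<open>E (Q V) = s (s - 1) Q h + s E (Q Z)\<close>, where \<open>E (Q Z) \<le> c1\<^sup>2 \<parallel>h\<parallel>\<^sub>1\<^sup>2\<close> by b). Together
  (\<open>sparse_lower_bound_extends\<close>),
  \<open>(s - 1) c0\<^sup>2 \<parallel>h\<parallel>\<^sub>2\<^sup>2 \<le> (s - 1) \<parallel>\<Gamma> h\<parallel>\<^sub>2\<^sup>2 + c1\<^sup>2 \<parallel>h\<parallel>\<^sub>1\<^sup>2\<close>.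
  For \<open>\<Gamma> h = 0\<close> this is the required bound. The expectation is replaced by a choice of the
  summands one after the other that keeps the conditional expectation from increasing
  (\<open>maurey_choice\<close>).
\<close>

text \<open>
  The bound is the expectation of \<open>B v v\<close> at \<open>v = w + Z\<^sub>1 + \<dots> + Z\<^sub>k\<close> for independent \<open>Z\<^sub>i\<close> that
  take the value \<open>z j\<close> with probability \<open>p j\<close>: the mean contributes \<open>B\<close> at \<open>w + k x\<close>, and each
  summand its \<open>B\<close>-variance \<open>E (B Z Z) - B x x\<close>. The bounds for the possible choices \<open>w + z j\<close> after one step average
  to the bound for \<open>w\<close>, so that one of the choices does not exceed it; the offset \<open>w\<close> carries the
  summands chosen so far through the induction.
\<close>

lemma maurey_choice:
  fixes B :: "'a::real_vector \<Rightarrow> 'a \<Rightarrow> real"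
  assumes B: "bilinear B" and sym: "\<And>u v. B u v = B v u"
    and I: "finite I" and p: "\<And>j. j \<in> I \<Longrightarrow> p j \<ge> 0" "sum p I = 1"
    and x: "x = (\<Sum>j\<in>I. p j *\<^sub>R z j)"
  shows "\<exists>js. length js = k \<and> set js \<subseteq> I \<and>
    B (w + sum_list (map z js)) (w + sum_list (map z js)) \<le>
      B (w + real k *\<^sub>R x) (w + real k *\<^sub>R x) + real k * ((\<Sum>j\<in>I. p j * B (z j) (z j)) - B x x)"
proof (induction k arbitrary: w)
  case 0
  show ?case by simp
next
  case (Suc k)
  define \<sigma> where "\<sigma> = (\<Sum>j\<in>I. p j * B (z j) (z j))"
  define F where "F k w = B (w + real k *\<^sub>R x) (w + real k *\<^sub>R x) + real k * (\<sigma> - B x x)" for k w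
  note expand = bilinear_ladd[OF B] bilinear_radd[OF B]
  have lin: "(\<Sum>j\<in>I. p j * B u (z j)) = B u x" for u
  proof -
    have "linear (B u)" using B by (simp add: bilinear_def)
    then show ?thesis by (simp add: x linear_sum linear_scale)
  qed
  have "(\<Sum>j\<in>I. p j * F k (w + z j)) = F (Suc k) w"
  proof -
    define u where "u = w + real k *\<^sub>R x"
    have "p j * F k (w + z j) =
      p j * (B u u + real k * (\<sigma> - B x x)) + 2 * (p j * B u (z j)) + p j * B (z j) (z j)" for j
    proof -
      have eq: "w + z j + real k *\<^sub>R x = u + z j" by (simp add: u_def)
      show ?thesis unfolding F_def eq expand sym[of "z j" u] by (simp add: algebra_simps)
    qed
    then have "(\<Sum>j\<in>I. p j * F k (w + z j)) =
      (\<Sum>j\<in>I. p j) * (B u u + real k * (\<sigma> - B x x)) + 2 * (\<Sum>j\<in>I. p j * B u (z j)) + \<sigma>"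
      by (simp only: sum.distrib sum_distrib_left sum_distrib_right \<sigma>_def)
    also have "\<dots> = B u u + real k * (\<sigma> - B x x) + 2 * B u x + \<sigma>" by (simp add: p lin)
    also have "\<dots> = F (Suc k) w"
    proof -
      have eq: "w + real (Suc k) *\<^sub>R x = u + x" by (simp add: u_def algebra_simps)
      show ?thesis unfolding F_def eq expand sym[of x u] by (simp add: algebra_simps)
    qed
    finally show ?thesis .
  qed
  moreover have "\<exists>j\<in>I. F k (w + z j) \<le> (\<Sum>j\<in>I. p j * F k (w + z j))" (is "\<exists>j\<in>I. _ \<le> ?M")
  proof (rule ccontr)
    assume "\<not> ?thesis"
    then have less: "?M < F k (w + z j)" if "j \<in> I" for j using that by auto
    obtain i where i: "i \<in> I" "p i > 0"
    proof -
      have "\<not> (\<forall>i\<in>I. p i = 0)" using p(2) by (metis sum.neutral zero_neq_one)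
      then show thesis using that p(1) by force
    qed
    have "(\<Sum>j\<in>I. p j * ?M) < ?M"
    proof (rule sum_strict_mono_ex1[OF I])
      show "\<forall>j\<in>I. p j * ?M \<le> p j * F k (w + z j)"
        using less p(1) by (meson less_imp_le mult_left_mono)
      show "\<exists>j\<in>I. p j * ?M < p j * F k (w + z j)"
        using less i by (intro bexI[of _ i] mult_strict_left_mono) auto
    qed
    then show False by (simp add: p(2) flip: sum_distrib_right)
  qed
  ultimately obtain j where j: "j \<in> I" "F k (w + z j) \<le> F (Suc k) w" by auto
  obtain js where js: "length js = k" "set js \<subseteq> I"
    "B (w + z j + sum_list (map z js)) (w + z j + sum_list (map z js)) \<le> F k (w + z j)"
    using Suc.IH[of "w + z j"] by (auto simp: F_def \<sigma>_def)
  show ?case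
    using j js by (intro exI[of _ "j # js"]) (auto simp: F_def \<sigma>_def add.assoc)
qed

lemma sum_list_scaled_axis_sparse:
  "sum_list (map (\<lambda>j. a j *\<^sub>R axis j 1) js) \<in> (sparse_vectors (int (length js)) :: (real ^ 'n) set)"
proof -
  have "{i. sum_list (map (\<lambda>j. a j *\<^sub>R (axis j 1 :: real ^ 'n)) js) $ i \<noteq> 0} \<subseteq> set js"
    by (induction js) (auto simp: axis_def split: if_splits)
  then have "card {i. sum_list (map (\<lambda>j. a j *\<^sub>R (axis j 1 :: real ^ 'n)) js) $ i \<noteq> 0} \<le> card (set js)"
    by (intro card_mono) auto
  also have "\<dots> \<le> length js" by (rule card_length)
  finally show ?thesis by (simp add: sparse_vectors_def)
qed

text \<open>
  Maurey's method for \<open>Q v = \<parallel>\<Gamma> v\<parallel>\<^sup>2 - c0\<^sup>2 \<parallel>v\<parallel>\<^sup>2\<close>: a sum of \<open>s\<close> signed multiples of basis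
  vectors is \<open>s\<close>-sparse, so that \<open>Q\<close> is nonnegative there.
\<close>

lemma sparse_lower_bound_extends:
  fixes \<Gamma> :: "real ^ 'n \<Rightarrow> real ^ 'm"
  assumes lin: "linear \<Gamma>" and s: "s > 0" and c0: "c0 \<ge> 0"
    and lower: "\<And>x. x \<in> sparse_vectors (int s) \<Longrightarrow> c0 * norm x \<le> norm (\<Gamma> x)"
    and upper: "\<And>j. norm (\<Gamma> (axis j 1)) \<le> c1"
  shows "(real s - 1) * (c0\<^sup>2 * (norm x)\<^sup>2) \<le>
    (real s - 1) * (norm (\<Gamma> x))\<^sup>2 + c1\<^sup>2 * (l1_norm x)\<^sup>2"
proof (cases "x = 0")
  case True
  then show ?thesis using s by (simp add: linear_0[OF lin] l1_norm_def)
next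
  case False
  define L where "L = l1_norm x"
  define B where "B u v = \<Gamma> u \<bullet> \<Gamma> v - c0\<^sup>2 * (u \<bullet> v)" for u v
  define p where "p j = \<bar>x $ j\<bar> / L" for j
  define z where "z j = (L * sgn (x $ j)) *\<^sub>R (axis j 1 :: real ^ 'n)" for j
  have L: "L > 0"
  proof -
    obtain i where "x $ i \<noteq> 0" using False by (auto simp: vec_eq_iff)
    then show ?thesis unfolding L_def l1_norm_def by (intro sum_pos2[of _ i]) auto
  qed
  have Q: "B v v = (norm (\<Gamma> v))\<^sup>2 - c0\<^sup>2 * (norm v)\<^sup>2" for v
    by (simp add: B_def power2_norm_eq_inner)
  have bil: "bilinear B"
    unfolding bilinear_def B_def
    by (auto intro!: linearI simp: linear_add[OF lin] linear_scale[OF lin] algebra_simps)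
  have p1: "sum p UNIV = 1"
    using L by (simp add: p_def L_def l1_norm_def flip: sum_divide_distrib)
  have x: "x = (\<Sum>j\<in>UNIV. p j *\<^sub>R z j)"
  proof -
    have "p j *\<^sub>R z j = (x $ j) *\<^sub>R axis j 1" for j
      using L by (simp add: p_def z_def abs_mult_sgn)
    then have "(\<Sum>j\<in>UNIV. p j *\<^sub>R z j) = (\<Sum>j\<in>UNIV. (x $ j) *\<^sub>R axis j 1)" by (simp only:)
    then show ?thesis by (simp add: vec_eq_iff axis_def if_distrib cong: if_cong)
  qed
  have Qz: "B (z j) (z j) \<le> c1\<^sup>2 * L\<^sup>2" for j
  proof -
    have "norm (\<Gamma> (z j)) = L * \<bar>sgn (x $ j)\<bar> * norm (\<Gamma> (axis j 1))"
      using L by (simp add: z_def linear_scale[OF lin] abs_mult)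
    also have "\<dots> \<le> L * 1 * c1"
      using L upper by (intro mult_mono) (auto simp: sgn_if)
    finally have "(norm (\<Gamma> (z j)))\<^sup>2 \<le> (L * 1 * c1)\<^sup>2" by (intro power_mono) auto
    also have "\<dots> = c1\<^sup>2 * L\<^sup>2" by (simp add: power_mult_distrib mult.commute)
    finally have "(norm (\<Gamma> (z j)))\<^sup>2 \<le> c1\<^sup>2 * L\<^sup>2" .
    moreover have "0 \<le> c0\<^sup>2 * (norm (z j))\<^sup>2" by simp
    ultimately show ?thesis unfolding Q by linarith
  qed
  have \<sigma>: "(\<Sum>j\<in>UNIV. p j * B (z j) (z j)) \<le> c1\<^sup>2 * L\<^sup>2"
  proof -
    have "(\<Sum>j\<in>UNIV. p j * B (z j) (z j)) \<le> (\<Sum>j\<in>UNIV. p j * (c1\<^sup>2 * L\<^sup>2))"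
      using L Qz by (intro sum_mono mult_left_mono) (auto simp: p_def)
    then show ?thesis by (simp add: p1 flip: sum_distrib_right)
  qed
  obtain js where js: "length js = s" and bound:
    "B (sum_list (map z js)) (sum_list (map z js)) \<le>
      B (real s *\<^sub>R x) (real s *\<^sub>R x) + real s * ((\<Sum>j\<in>UNIV. p j * B (z j) (z j)) - B x x)"
    using maurey_choice[OF bil _ finite _ p1 x, of s 0] L
    by (auto simp: B_def inner_commute p_def)
  have "0 \<le> B (sum_list (map z js)) (sum_list (map z js))"
  proof -
    have "sum_list (map z js) \<in> sparse_vectors (int s)"
      unfolding z_def using sum_list_scaled_axis_sparse[of _ js] js by simp
    then have "(c0 * norm (sum_list (map z js)))\<^sup>2 \<le> (norm (\<Gamma> (sum_list (map z js))))\<^sup>2"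
      using lower c0 by (intro power_mono) auto
    then show ?thesis by (simp add: Q power_mult_distrib)
  qed
  also note bound
  also have "B (real s *\<^sub>R x) (real s *\<^sub>R x) + real s * ((\<Sum>j\<in>UNIV. p j * B (z j) (z j)) - B x x)
    = real s * ((real s - 1) * B x x + (\<Sum>j\<in>UNIV. p j * B (z j) (z j)))"
    by (simp add: bilinear_lmul[OF bil] bilinear_rmul[OF bil] algebra_simps)
  finally have "0 \<le> (real s - 1) * B x x + (\<Sum>j\<in>UNIV. p j * B (z j) (z j))"
    using s by (simp add: zero_le_mult_iff)
  then show ?thesis using \<sigma> by (simp add: Q L_def algebra_simps)
qed

text \<open>
  The null space property suffices: applied to \<open>h = t - x0\<close> and the support of \<open>x0\<close>, it says that
  \<open>h\<close> has more mass off the support, where \<open>t = h\<close>, than on it.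
\<close>

lemma exact_reconstructionI:
  fixes \<Gamma> :: "real ^ 'n \<Rightarrow> real ^ 'm"
  assumes lin: "linear \<Gamma>"
    and null: "\<And>h I. \<Gamma> h = 0 \<Longrightarrow> h \<noteq> 0 \<Longrightarrow> int (card I) \<le> k \<Longrightarrow>
      2 * (\<Sum>i\<in>I. \<bar>h $ i\<bar>) < l1_norm h"
  shows "exact_reconstruction \<Gamma> (sparse_vectors k)"
  unfolding exact_reconstruction_def
proof
  fix x0 :: "real ^ 'n" assume x0: "x0 \<in> sparse_vectors k"
  have less: "l1_norm x0 < l1_norm t" if t: "\<Gamma> t = \<Gamma> x0" "t \<noteq> x0" for t
  proof -
    define I where "I = {i. x0 $ i \<noteq> 0}"
    define h where "h = t - x0"
    have split: "l1_norm v = (\<Sum>i\<in>I. \<bar>v $ i\<bar>) + (\<Sum>i\<in>-I. \<bar>v $ i\<bar>)" for v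
      unfolding l1_norm_def by (simp add: sum.subset_diff[of I UNIV] Compl_eq_Diff_UNIV)
    have "2 * (\<Sum>i\<in>I. \<bar>h $ i\<bar>) < l1_norm h"
      using t x0 by (intro null) (auto simp: h_def I_def linear_diff[OF lin] sparse_vectors_def)
    then have gap: "(\<Sum>i\<in>I. \<bar>h $ i\<bar>) < (\<Sum>i\<in>-I. \<bar>h $ i\<bar>)" using split[of h] by simp
    have "l1_norm x0 = (\<Sum>i\<in>I. \<bar>x0 $ i\<bar>)" using split[of x0] by (simp add: I_def)
    also have "\<dots> \<le> (\<Sum>i\<in>I. \<bar>t $ i\<bar> + \<bar>h $ i\<bar>)" by (intro sum_mono) (simp add: h_def)
    also have "\<dots> < (\<Sum>i\<in>I. \<bar>t $ i\<bar>) + (\<Sum>i\<in>-I. \<bar>h $ i\<bar>)" using gap by (simp add: sum.distrib)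
    also have "(\<Sum>i\<in>-I. \<bar>h $ i\<bar>) = (\<Sum>i\<in>-I. \<bar>t $ i\<bar>)"
      by (intro sum.cong) (auto simp: h_def I_def)
    finally show ?thesis by (simp add: split)
  qed
  then show "{t. is_arg_min l1_norm (\<lambda>t. \<Gamma> t = \<Gamma> x0) t} = {x0}"
    by (fastforce simp: is_arg_min_def dest: less_asym)
qed

theorem theoremB:
  fixes \<Gamma> :: "real ^ 'n \<Rightarrow> real ^ 'm"
    and s :: nat and c0 c1 :: real and s1 :: int
  assumes "linear \<Gamma>"
    and "s > 0" and "c0 > 0" and "c1 > 0"
    and "\<forall>x\<in>sparse_vectors (int s). norm (\<Gamma> x) \<ge> c0 * norm x"
    and "\<forall>j. norm (\<Gamma> (axis j 1)) \<le> c1"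
    and "s1 = \<lfloor>c0\<^sup>2 * (real s - 1) / (4 * c1\<^sup>2)\<rfloor> - 1"
  shows "exact_reconstruction \<Gamma> (sparse_vectors s1)"
proof (rule exact_reconstructionI[OF assms(1)])
  fix h :: "real ^ 'n" and I :: "'n set"
  assume h: "\<Gamma> h = 0" "h \<noteq> 0" and I: "int (card I) \<le> s1"
  define m where "m = (\<Sum>i\<in>I. \<bar>h $ i\<bar>)"
  have "m\<^sup>2 \<le> real (card I) * (norm h)\<^sup>2"
  proof -
    have "m\<^sup>2 \<le> (\<Sum>i\<in>I. 1\<^sup>2) * (\<Sum>i\<in>I. \<bar>h $ i\<bar>\<^sup>2)"
      using Cauchy_Schwarz_ineq_sum[of "\<lambda>_. 1" "\<lambda>i. \<bar>h $ i\<bar>" I] by (simp add: m_def)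
    also have "\<dots> \<le> real (card I) * (\<Sum>i\<in>UNIV. \<bar>h $ i\<bar>\<^sup>2)"
      by (simp, intro mult_left_mono sum_mono2) auto
    also have "(\<Sum>i\<in>UNIV. \<bar>h $ i\<bar>\<^sup>2) = (norm h)\<^sup>2"
      unfolding power2_norm_eq_inner by (simp add: inner_vec_def power2_eq_square)
    finally show ?thesis .
  qed
  then have "4 * c1\<^sup>2 * m\<^sup>2 \<le> (4 * c1\<^sup>2 * real (card I)) * (norm h)\<^sup>2"
    using mult_left_mono[of "m\<^sup>2" _ "4 * c1\<^sup>2"] by (simp add: mult.assoc)
  also have "\<dots> < (c0\<^sup>2 * (real s - 1)) * (norm h)\<^sup>2"
  proof -
    \<comment> \<open>The \<open>- 1\<close> in \<open>s1\<close> makes this strict, and with it the null space inequality.\<close>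
    have "real (card I) < c0\<^sup>2 * (real s - 1) / (4 * c1\<^sup>2)"
      using I assms(7) by linarith
    then show ?thesis
      using h assms(4) by (intro mult_strict_right_mono) (auto simp: field_simps)
  qed
  also have "\<dots> \<le> c1\<^sup>2 * (l1_norm h)\<^sup>2"
    using sparse_lower_bound_extends[of \<Gamma> s c0 c1 h] assms h by (simp add: mult_ac)
  finally have "c1\<^sup>2 * (2 * m)\<^sup>2 < c1\<^sup>2 * (l1_norm h)\<^sup>2" by (simp add: power_mult_distrib mult_ac)
  then have "(2 * m)\<^sup>2 < (l1_norm h)\<^sup>2" using assms(4) by simp
  moreover have "l1_norm h \<ge> 0" by (simp add: l1_norm_def sum_nonneg)
  ultimately have "2 * m < l1_norm h" by (rule power2_less_imp_less)
  then show "2 * (\<Sum>i\<in>I. \<bar>h $ i\<bar>) < l1_norm h" by (simp add: m_def)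
qed

end
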